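(* Let $X$ be a metric space with metric $d_X$ and let $f$ be a surjective set map from the underlying set of $X$ to a set $Y$. Then the quotient large scale structure on $Y$ with respect to $f$ is induced by the metric $d'_f$ defined by $d'_f(y,y)=0$ and, for $y\ne y'$, $$d'_f(y,y')=\inf\Big\{n+\sum_{i=1}^n d_X(a_i,b_i)\ \Big|\ f(a_1)=y,\ f(b_n)=y',\ f(b_i)=f(a_{i+1})\ (1\le i<n),\ n\in\mathbb{Z}_+\Big\},$$ where the $a_i,b_i$ range over $X$.
   Context: For families of subsets of $X$, $\mathrm{st}(\mathcal{B},\mathcal{U})=\{\mathrm{st}(B,\mathcal{U})\mid B\in\mathcal{B}\}$, where $\mathrm{st}(B,\mathcal{U})$ is the union of the elements of $\mathcal{U}$ that intersect $B$. A large scale structure on a set $X$ is a nonempty set of families of subsets of $X$ (the uniformly bounded families) such that (1) if $\mathcal{B}_1$ is uniformly bounded and each element of $\mathcal{B}_2$ with more than one point is contained in some element of $\mathcal{B}_1$, then $\mathcal{B}_2$ is uniformly bounded; (2) $\mathrm{st}(\mathcal{B}_1,\mathcal{B}_2)$ is uniformly bounded whenever $\mathcal{B}_1,\mathcal{B}_2$ are. The large scale structure induced by a metric $d$ consists of all families $\mathcal{U}$ with $\sup_{U\in\mathcal{U}}\mathrm{diam}(U)<\infty$. If $X$ has large scale structure $\mathcal{X}$ and $f:X\to Y$ is a surjective set map, the quotient large scale structure on $Y$ with respect to $f$ is the smallest large scale structure on $Y$ containing all families $f(\mathcal{U})=\{f(U)\mid U\in\mathcal{U}\}$, $\mathcal{U}\in\mathcal{X}$.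 *)

theory Defs
  imports "HOL-Analysis.Analysis"
begin

text \<open>Spaces are explicit carrier sets, so that empty spaces are included; a family of
  subsets of \<open>X\<close> is an element of \<^term>\<open>Pow (Pow X)\<close>.\<close>

definition star :: "'a set \<Rightarrow> 'a set set \<Rightarrow> 'a set" where
  "star B \<U> = \<Union>{U \<in> \<U>. U \<inter> B \<noteq> {}}"

definition star_family :: "'a set set \<Rightarrow> 'a set set \<Rightarrow> 'a set set" where
  "star_family \<B> \<U> = (\<lambda>B. star B \<U>) ` \<B>"

definition large_scale_structure :: "'a set \<Rightarrow> 'a set set set \<Rightarrow> bool" where
  "large_scale_structure X \<X> \<longleftrightarrow>
     \<X> \<subseteq> Pow (Pow X) \<and> \<X> \<noteq> {} \<and>
     (\<forall>\<B>1\<in>\<X>. \<forall>\<B>2\<in>Pow (Pow X).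
        (\<forall>B\<in>\<B>2. (\<exists>x\<in>B. \<exists>y\<in>B. x \<noteq> y) \<longrightarrow> (\<exists>A\<in>\<B>1. B \<subseteq> A)) \<longrightarrow> \<B>2 \<in> \<X>) \<and>
     (\<forall>\<B>1\<in>\<X>. \<forall>\<B>2\<in>\<X>. star_family \<B>1 \<B>2 \<in> \<X>)"

text \<open>The diameter is taken in \<^typ>\<open>ennreal\<close>: the library's real-valued
  \<^const>\<open>diameter\<close> does not detect unbounded sets. The empty set has diameter \<open>0\<close>.\<close>

definition ediam :: "('a \<Rightarrow> 'a \<Rightarrow> real) \<Rightarrow> 'a set \<Rightarrow> ennreal" where
  "ediam d U = (SUP x\<in>U. SUP y\<in>U. ennreal (d x y))"

definition metric_lss :: "'a set \<Rightarrow> ('a \<Rightarrow> 'a \<Rightarrow> real) \<Rightarrow> 'a set set set" where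
  "metric_lss X d = {\<U> \<in> Pow (Pow X). (SUP U\<in>\<U>. ediam d U) < \<infinity>}"

text \<open>\<open>is_quotient_lss f \<X> Y \<Y>\<close>: \<open>\<Y>\<close> is the smallest large scale structure on \<open>Y\<close> containing
  the image of every member of \<open>\<X>\<close>.\<close>

definition is_quotient_lss ::
  "('a \<Rightarrow> 'b) \<Rightarrow> 'a set set set \<Rightarrow> 'b set \<Rightarrow> 'b set set set \<Rightarrow> bool" where
  "is_quotient_lss f \<X> Y \<Y> \<longleftrightarrow>
     large_scale_structure Y \<Y> \<and> (\<forall>\<U>\<in>\<X>. (`) f ` \<U> \<in> \<Y>) \<and>
     (\<forall>\<Z>. large_scale_structure Y \<Z> \<and> (\<forall>\<U>\<in>\<X>. (`) f ` \<U> \<in> \<Z>) \<longrightarrow> \<Y> \<subseteq> \<Z>)"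

definition chain_lengths ::
  "'a set \<Rightarrow> ('a \<Rightarrow> 'a \<Rightarrow> real) \<Rightarrow> ('a \<Rightarrow> 'b) \<Rightarrow> 'b \<Rightarrow> 'b \<Rightarrow> real set" where
  "chain_lengths X d f y y' =
     {real n + (\<Sum>i=1..n. d (a i) (b i)) | (n::nat) a b.
        1 \<le> n \<and> (\<forall>i\<in>{1..n}. a i \<in> X \<and> b i \<in> X) \<and>
        f (a 1) = y \<and> f (b n) = y' \<and>
        (\<forall>i. 1 \<le> i \<and> i < n \<longrightarrow> f (b i) = f (a (Suc i)))}"

text \<open>Off the carrier \<open>f ` X\<close> there are no chains; the value is set to \<open>0\<close> there because
  \<^const>\<open>Metric_space\<close> demands nonnegativity on the whole type.\<close>

definition quotient_dist ::
  "'a set \<Rightarrow> ('a \<Rightarrow> 'a \<Rightarrow> real) \<Rightarrow> ('a \<Rightarrow> 'b) \<Rightarrow> 'b \<Rightarrow> 'b \<Rightarrow> real" where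
  "quotient_dist X d f y y' =
     (if y \<in> f ` X \<and> y' \<in> f ` X \<and> y \<noteq> y' then Inf (chain_lengths X d f y y') else 0)"

end

theory Submission
  imports Defs
begin

text \<open>A family bounded for the quotient metric consists of sets any two points of which are
  joined by a chain whose number of steps and whose step lengths are all below a common \<open>N\<close>.
  Every such step joins two points that share a member of the family
  \<open>\<V> = {{f a, f b} | d a b \<le> N}\<close>, which belongs to every large scale structure that
  contains the images of bounded families. So every bounded set lies in an \<open>N\<close>-fold
  iterated star of a point, and these stars form a uniformly bounded family. Conversely, chains
  with a single step show that \<open>f\<close> increases distances by at most \<open>1\<close>.\<close>

section \<open>Metrically bounded families\<close>

text \<open>A finite supremum in \<open>ennreal\<close> is itself a real bound, and conversely a
  real bound passes through all the suprema. This reduces uniform boundedness to estimates on pairs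
  of points.\<close>

lemma metric_lss_iff:
  "\<U> \<in> metric_lss X d \<longleftrightarrow>
     \<U> \<subseteq> Pow X \<and> (\<exists>R. \<forall>U\<in>\<U>. \<forall>x\<in>U. \<forall>y\<in>U. d x y \<le> R)"
proof -
  have "(SUP U\<in>\<U>. ediam d U) < \<infinity> \<longleftrightarrow> (\<exists>R. \<forall>U\<in>\<U>. \<forall>x\<in>U. \<forall>y\<in>U. d x y \<le> R)"
  proof
    assume fin: "(SUP U\<in>\<U>. ediam d U) < \<infinity>"
    define R where "R = enn2real (SUP U\<in>\<U>. ediam d U)"
    have "d x y \<le> R" if "U \<in> \<U>" "x \<in> U" "y \<in> U" for U x y
    proof -
      have "ennreal (d x y) \<le> ediam d U"
        unfolding ediam_def using that by (blast intro: SUP_upper2)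
      also have "\<dots> \<le> (SUP U\<in>\<U>. ediam d U)"
        using that by (blast intro: SUP_upper)
      also have "\<dots> = ennreal R"
        using fin by (simp add: R_def less_top)
      finally show ?thesis
        \<comment> \<open>\<open>enn2real\<close> makes \<open>R\<close> nonnegative, so the
          comparison descends to the reals whatever the sign of \<open>d x y\<close>.\<close>
        by (simp add: R_def ennreal_le_iff)
    qed
    then show "\<exists>R. \<forall>U\<in>\<U>. \<forall>x\<in>U. \<forall>y\<in>U. d x y \<le> R"
      by blast
  next
    assume "\<exists>R. \<forall>U\<in>\<U>. \<forall>x\<in>U. \<forall>y\<in>U. d x y \<le> R"
    then obtain R where "\<forall>U\<in>\<U>. \<forall>x\<in>U. \<forall>y\<in>U. d x y \<le> R"
      by blast
    then have "(SUP U\<in>\<U>. ediam d U) \<le> ennreal R"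
      unfolding ediam_def by (intro SUP_least ennreal_leI) blast
    then show "(SUP U\<in>\<U>. ediam d U) < \<infinity>"
      by (simp add: order_le_less_trans)
  qed
  then show ?thesis
    unfolding metric_lss_def by auto
qed

lemma metric_lssI:
  assumes "\<U> \<subseteq> Pow X" and "\<And>U x y. \<lbrakk>U \<in> \<U>; x \<in> U; y \<in> U\<rbrakk> \<Longrightarrow> d x y \<le> R"
  shows "\<U> \<in> metric_lss X d"
  unfolding metric_lss_iff by (intro conjI exI[of _ R] ballI assms)

lemma metric_lssE:
  assumes "\<U> \<in> metric_lss X d"
  obtains R where "\<And>U x y. \<lbrakk>U \<in> \<U>; x \<in> U; y \<in> U\<rbrakk> \<Longrightarrow> d x y \<le> R"
proof -
  have "\<exists>R. \<forall>U\<in>\<U>. \<forall>x\<in>U. \<forall>y\<in>U. d x y \<le> R"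
    using assms by (simp add: metric_lss_iff)
  then obtain R where R: "\<forall>U\<in>\<U>. \<forall>x\<in>U. \<forall>y\<in>U. d x y \<le> R" ..
  show thesis
    by (rule that[of R]) (rule R[rule_format])
qed

lemma metric_lss_subset: "\<U> \<in> metric_lss X d \<Longrightarrow> \<U> \<subseteq> Pow X"
  by (simp add: metric_lss_iff)

lemma star_subset: "\<U> \<subseteq> Pow X \<Longrightarrow> star B \<U> \<subseteq> X"
  unfolding star_def by auto

text \<open>Two points of \<open>star B \<B>2\<close> each lie in a member of \<open>\<B>2\<close>
  meeting \<open>B\<close>; passing through \<open>B\<close> bounds their distance by
  \<open>S + R + S\<close>.\<close>

lemma large_scale_structure_metric_lss:
  assumes "Metric_space X d"
  shows "large_scale_structure X (metric_lss X d)"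
  unfolding large_scale_structure_def
proof (intro conjI ballI impI)
  show "metric_lss X d \<subseteq> Pow (Pow X)"
    by (auto dest: metric_lss_subset)
  have "{} \<in> metric_lss X d"
    by (simp add: metric_lss_iff)
  then show "metric_lss X d \<noteq> {}"
    by blast
next
  interpret Metric_space X d by fact
  fix \<B>1 \<B>2
  assume \<B>1: "\<B>1 \<in> metric_lss X d" and \<B>2: "\<B>2 \<in> Pow (Pow X)"
    and refines: "\<forall>B\<in>\<B>2. (\<exists>x\<in>B. \<exists>y\<in>B. x \<noteq> y) \<longrightarrow> (\<exists>A\<in>\<B>1. B \<subseteq> A)"
  obtain R where R: "\<And>U x y. \<lbrakk>U \<in> \<B>1; x \<in> U; y \<in> U\<rbrakk> \<Longrightarrow> d x y \<le> R"
    using \<B>1 by (rule metric_lssE) (rule that)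
  show "\<B>2 \<in> metric_lss X d"
  proof (rule metric_lssI)
    show "\<B>2 \<subseteq> Pow X"
      using \<B>2 by blast
    fix B x y assume B: "B \<in> \<B>2" "x \<in> B" "y \<in> B"
    \<comment> \<open>\<open>R\<close> may be negative if \<open>\<B>1\<close> has no nonempty
      member; the maximum with 0 also handles \<open>x = y\<close>, where no \<open>A\<close>
      containing \<open>B\<close> need exist.\<close>
    show "d x y \<le> max 0 R"
    proof (cases "x = y")
      case True
      moreover have "y \<in> X"
        using B \<B>2 by blast
      ultimately show ?thesis
        by simp
    next
      case False
      then have "\<exists>x\<in>B. \<exists>y\<in>B. x \<noteq> y"
        using B(2,3) by blast
      then obtain A where "A \<in> \<B>1" "B \<subseteq> A"
        using refines B(1) by blast
      then have "d x y \<le> R"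
        using B(2,3) by (intro R[of A]) auto
      then show ?thesis
        by simp
    qed
  qed
next
  interpret Metric_space X d by fact
  fix \<B>1 \<B>2
  assume \<B>1: "\<B>1 \<in> metric_lss X d" and \<B>2: "\<B>2 \<in> metric_lss X d"
  obtain R where R: "\<And>U x y. \<lbrakk>U \<in> \<B>1; x \<in> U; y \<in> U\<rbrakk> \<Longrightarrow> d x y \<le> R"
    using \<B>1 by (rule metric_lssE) (rule that)
  obtain S where S: "\<And>U x y. \<lbrakk>U \<in> \<B>2; x \<in> U; y \<in> U\<rbrakk> \<Longrightarrow> d x y \<le> S"
    using \<B>2 by (rule metric_lssE) (rule that)
  note sub1 = metric_lss_subset[OF \<B>1] and sub2 = metric_lss_subset[OF \<B>2]
  show "star_family \<B>1 \<B>2 \<in> metric_lss X d"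
  proof (rule metric_lssI)
    show "star_family \<B>1 \<B>2 \<subseteq> Pow X"
      using star_subset[OF sub2] unfolding star_family_def by blast
    fix W x y assume W: "W \<in> star_family \<B>1 \<B>2" and x: "x \<in> W" and y: "y \<in> W"
    obtain B where B: "B \<in> \<B>1" "W = star B \<B>2"
      using W unfolding star_family_def by blast
    obtain U u where U: "U \<in> \<B>2" "x \<in> U" "u \<in> U" "u \<in> B"
      using x unfolding B(2) star_def by blast
    obtain V v where V: "V \<in> \<B>2" "y \<in> V" "v \<in> V" "v \<in> B"
      using y unfolding B(2) star_def by blast
    have X: "x \<in> X" "y \<in> X" "u \<in> X" "v \<in> X"
      using B U V sub1 sub2 by auto
    have "d x y \<le> d x u + d u y" "d u y \<le> d u v + d v y"
      using X by (simp_all add: triangle)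
    with S[OF U(1-3)] R[OF B(1) U(4) V(4)] S[OF V(1,3,2)] show "d x y \<le> S + R + S"
      by linarith
  qed
qed

section \<open>Iterated stars\<close>

lemma subset_star: "B \<subseteq> \<Union>\<V> \<Longrightarrow> B \<subseteq> star B \<V>"
  unfolding star_def by blast

lemma iterated_star_subset:
  assumes "\<V> \<subseteq> Pow Y" "B \<subseteq> Y"
  shows "((\<lambda>A. star A \<V>) ^^ n) B \<subseteq> Y"
  using assms star_subset[OF assms(1)] by (cases n) auto

text \<open>As \<open>\<V>\<close> covers \<open>Y\<close>, every subset of \<open>Y\<close> lies in
  its own star. Hence short chains can be padded to a common length.\<close>

lemma iterated_star_mono:
  assumes "\<Union>\<V> = Y" "B \<subseteq> Y" "m \<le> n"
  shows "((\<lambda>A. star A \<V>) ^^ m) B \<subseteq> ((\<lambda>A. star A \<V>) ^^ n) B"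
  using assms(3)
proof (induction rule: dec_induct)
  case base
  then show ?case by simp
next
  case (step n)
  have "((\<lambda>A. star A \<V>) ^^ n) B \<subseteq> Y"
    using assms by (intro iterated_star_subset) auto
  then show ?case
    using step.IH subset_star[of "((\<lambda>A. star A \<V>) ^^ n) B" \<V>] assms(1) by auto
qed

text \<open>Induction on \<open>n\<close>: singletons satisfy the refinement condition of the first
  axiom vacuously, and each further star is one application of the second axiom.\<close>

lemma iterated_star_family_in_lss:
  assumes lss: "large_scale_structure Y \<Z>" and \<V>: "\<V> \<in> \<Z>"
  shows "(\<lambda>y. ((\<lambda>A. star A \<V>) ^^ n) {y}) ` Y \<in> \<Z>"
proof (induction n)
  case 0
  have "(\<lambda>y. {y}) ` Y \<in> Pow (Pow Y)"
    by blast
  moreover have "\<forall>B\<in>(\<lambda>y. {y}) ` Y. (\<exists>x\<in>B. \<exists>y\<in>B. x \<noteq> y) \<longrightarrow> (\<exists>A\<in>\<V>. B \<subseteq> A)"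
    by simp
  ultimately show ?case
    using lss \<V> unfolding large_scale_structure_def by simp
next
  case (Suc n)
  then have "star_family ((\<lambda>y. ((\<lambda>A. star A \<V>) ^^ n) {y}) ` Y) \<V> \<in> \<Z>"
    using lss \<V> unfolding large_scale_structure_def by blast
  then show ?case
    by (simp add: star_family_def image_image)
qed

text \<open>The link \<open>{f (a i), f (b i)}\<close> meets the iterate already reached in
  \<open>f (a i)\<close>, so one further star adds \<open>f (b i)\<close>: each link costs one
  star.\<close>

lemma chain_in_iterated_star:
  assumes links: "\<And>i. \<lbrakk>1 \<le> i; i \<le> n\<rbrakk> \<Longrightarrow> {f (a i), f (b i)} \<in> \<V>"
    and glue: "\<And>i. \<lbrakk>1 \<le> i; i < n\<rbrakk> \<Longrightarrow> f (b i) = f (a (Suc i))"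
    and n: "1 \<le> n"
  shows "f (b n) \<in> ((\<lambda>A. star A \<V>) ^^ n) {f (a 1)}"
proof -
  have "f (b k) \<in> ((\<lambda>A. star A \<V>) ^^ k) {f (a 1)}" if "1 \<le> k" "k \<le> n" for k
    using that
  proof (induction rule: dec_induct)
    case base
    then show ?case
      using links[of 1] n unfolding star_def by auto
  next
    case (step k)
    then have "f (a (Suc k)) \<in> ((\<lambda>A. star A \<V>) ^^ k) {f (a 1)}"
      using glue[of k] by simp
    moreover have "{f (a (Suc k)), f (b (Suc k))} \<in> \<V>"
      using links[of "Suc k"] step.prems by simp
    ultimately show ?case
      unfolding star_def by auto
  qed
  then show ?thesis
    using n by blast
qed

section \<open>The quotient metric\<close>

lemma chain_lengthsI:
  assumes "1 \<le> n" and "\<And>i. \<lbrakk>1 \<le> i; i \<le> n\<rbrakk> \<Longrightarrow> a i \<in> X \<and> b i \<in> X"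
    and "f (a 1) = y" and "f (b n) = y'"
    and "\<And>i. \<lbrakk>1 \<le> i; i < n\<rbrakk> \<Longrightarrow> f (b i) = f (a (Suc i))"
    and "s = real n + (\<Sum>i=1..n. d (a i) (b i))"
  shows "s \<in> chain_lengths X d f y y'"
  unfolding chain_lengths_def mem_Collect_eq
  by (rule exI[of _ n], rule exI[of _ a], rule exI[of _ b]) (use assms in auto)

lemma chain_lengthsE:
  assumes "s \<in> chain_lengths X d f y y'"
  obtains n a b where "1 \<le> n" and "\<And>i. \<lbrakk>1 \<le> i; i \<le> n\<rbrakk> \<Longrightarrow> a i \<in> X \<and> b i \<in> X"
    and "f (a 1) = y" and "f (b n) = y'"
    and "\<And>i. \<lbrakk>1 \<le> i; i < n\<rbrakk> \<Longrightarrow> f (b i) = f (a (Suc i))"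
    and "s = real n + (\<Sum>i=1..n. d (a i) (b i))"
proof -
  obtain n a b where "1 \<le> n" "\<forall>i\<in>{1..n}. a i \<in> X \<and> b i \<in> X"
    "f (a 1) = y" "f (b n) = y'" "\<forall>i. 1 \<le> i \<and> i < n \<longrightarrow> f (b i) = f (a (Suc i))"
    "s = real n + (\<Sum>i=1..n. d (a i) (b i))"
    using assms unfolding chain_lengths_def by blast
  then show thesis
    by (intro that[of n a b]) simp_all
qed

lemma chain_lengths_single:
  assumes "x \<in> X" "x' \<in> X"
  shows "1 + d x x' \<in> chain_lengths X d f (f x) (f x')"
  by (rule chain_lengthsI[of 1 "\<lambda>_. x" X "\<lambda>_. x'"]) (use assms in auto)

text \<open>Concatenation adds both the link counts and the distance sums; this is the source of the
  triangle inequality.\<close>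

lemma chain_lengths_append:
  assumes "s \<in> chain_lengths X d f x y" "t \<in> chain_lengths X d f y z"
  shows "s + t \<in> chain_lengths X d f x z"
proof -
  obtain n a b where n: "1 \<le> n" "\<And>i. \<lbrakk>1 \<le> i; i \<le> n\<rbrakk> \<Longrightarrow> a i \<in> X \<and> b i \<in> X"
      "f (a 1) = x" "f (b n) = y" "\<And>i. \<lbrakk>1 \<le> i; i < n\<rbrakk> \<Longrightarrow> f (b i) = f (a (Suc i))"
      "s = real n + (\<Sum>i=1..n. d (a i) (b i))"
    using assms(1) by (rule chain_lengthsE) (rule that)
  obtain m a' b' where m: "1 \<le> m" "\<And>i. \<lbrakk>1 \<le> i; i \<le> m\<rbrakk> \<Longrightarrow> a' i \<in> X \<and> b' i \<in> X"
      "f (a' 1) = y" "f (b' m) = z" "\<And>i. \<lbrakk>1 \<le> i; i < m\<rbrakk> \<Longrightarrow> f (b' i) = f (a' (Suc i))"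
      "t = real m + (\<Sum>i=1..m. d (a' i) (b' i))"
    using assms(2) by (rule chain_lengthsE) (rule that)
  define a'' where "a'' i = (if i \<le> n then a i else a' (i - n))" for i
  define b'' where "b'' i = (if i \<le> n then b i else b' (i - n))" for i
  have "(\<Sum>i=1..n+m. d (a'' i) (b'' i)) =
      (\<Sum>i=1..n. d (a'' i) (b'' i)) + (\<Sum>i=n+1..n+m. d (a'' i) (b'' i))"
    using n(1) by (intro sum.ub_add_nat) simp
  also have "(\<Sum>i=1..n. d (a'' i) (b'' i)) = (\<Sum>i=1..n. d (a i) (b i))"
    by (simp add: a''_def b''_def)
  also have "(\<Sum>i=n+1..n+m. d (a'' i) (b'' i)) = (\<Sum>i=1..m. d (a'' (i + n)) (b'' (i + n)))"
    using sum.shift_bounds_cl_nat_ivl[of "\<lambda>i. d (a'' i) (b'' i)" 1 n m] by (simp add: add.commute)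
  also have "\<dots> = (\<Sum>i=1..m. d (a' i) (b' i))"
    by (intro sum.cong) (auto simp: a''_def b''_def)
  finally have sum: "(\<Sum>i=1..n+m. d (a'' i) (b'' i)) =
      (\<Sum>i=1..n. d (a i) (b i)) + (\<Sum>i=1..m. d (a' i) (b' i))" .
  show ?thesis
  proof (rule chain_lengthsI[of "n + m" a'' X b''])
    show "a'' i \<in> X \<and> b'' i \<in> X" if "1 \<le> i" "i \<le> n + m" for i
      using that n(2)[of i] m(2)[of "i - n"] by (simp add: a''_def b''_def)
    show "f (b'' i) = f (a'' (Suc i))" if "1 \<le> i" "i < n + m" for i
    proof -
      consider "i < n" | "i = n" | "n < i"
        by linarith
      then show ?thesis
      proof cases
        case 1
        then show ?thesis using that n(5)[of i] by (simp add: a''_def b''_def)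
      next
        \<comment> \<open>At the junction both ends map to \<open>y\<close>, although
          \<open>b n\<close> and \<open>a' 1\<close> may differ in \<open>X\<close>.\<close>
        case 2
        then show ?thesis using n(4) m(3) by (simp add: a''_def b''_def)
      next
        case 3
        then show ?thesis using that m(5)[of "i - n"] by (simp add: a''_def b''_def Suc_diff_le)
      qed
    qed
  qed (use n(1,3,6) m(1,4,6) sum in \<open>auto simp: a''_def b''_def\<close>)
qed

text \<open>Reading the chain backwards swaps the roles of \<open>a\<close> and \<open>b\<close> and
  replaces \<open>i\<close> by \<open>n + 1 - i\<close>, which keeps indices between 1 and
  \<open>n\<close>.\<close>

lemma chain_lengths_reverse:
  assumes "\<And>u v. d u v = d v u" and "s \<in> chain_lengths X d f y y'"
  shows "s \<in> chain_lengths X d f y' y"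
proof -
  obtain n a b where n: "1 \<le> n" "\<And>i. \<lbrakk>1 \<le> i; i \<le> n\<rbrakk> \<Longrightarrow> a i \<in> X \<and> b i \<in> X"
      "f (a 1) = y" "f (b n) = y'" "\<And>i. \<lbrakk>1 \<le> i; i < n\<rbrakk> \<Longrightarrow> f (b i) = f (a (Suc i))"
      "s = real n + (\<Sum>i=1..n. d (a i) (b i))"
    using assms(2) by (rule chain_lengthsE) (rule that)
  have sum: "(\<Sum>i=1..n. d (a i) (b i)) = (\<Sum>i=1..n. d (b (n + 1 - i)) (a (n + 1 - i)))"
    by (subst sum.atLeastAtMost_rev) (simp add: assms(1) add.commute)
  show ?thesis
  proof (rule chain_lengthsI[of n "\<lambda>i. b (n + 1 - i)" X "\<lambda>i. a (n + 1 - i)"])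
    show "b (n + 1 - i) \<in> X \<and> a (n + 1 - i) \<in> X" if "1 \<le> i" "i \<le> n" for i
      using that n(2)[of "n + 1 - i"] by auto
    show "f (a (n + 1 - i)) = f (b (n + 1 - Suc i))" if "1 \<le> i" "i < n" for i
      using that n(5)[of "n - i"] by (simp add: Suc_diff_le)
  qed (use n(1,3,4,6) sum in auto)
qed

section \<open>Metric axioms for the quotient distance\<close>

context
  fixes X :: "'a set" and d :: "'a \<Rightarrow> 'a \<Rightarrow> real" and f :: "'a \<Rightarrow> 'b"
  assumes metric: "Metric_space X d"
begin

interpretation Metric_space X d
  by (fact metric)

text \<open>The term \<open>n\<close> alone contributes at least 1. This gap makes the infimum
  positive between distinct points, even when their fibres have distance 0 in
  \<open>X\<close>.\<close>

lemma chain_lengths_ge_1: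
  assumes "s \<in> chain_lengths X d f y y'"
  shows "1 \<le> s"
  using assms
proof (rule chain_lengthsE)
  fix n a b assume "1 \<le> n" "s = real n + (\<Sum>i=1..n. d (a i) (b i))"
  moreover have "0 \<le> (\<Sum>i=1..n. d (a i) (b i))"
    by (simp add: sum_nonneg)
  ultimately show ?thesis
    by simp
qed

lemma bdd_below_chain_lengths: "bdd_below (chain_lengths X d f y y')"
  using chain_lengths_ge_1 by (intro bdd_belowI)

lemma chain_lengths_nonempty:
  "y \<in> f ` X \<Longrightarrow> y' \<in> f ` X \<Longrightarrow> chain_lengths X d f y y' \<noteq> {}"
  by (elim imageE) (metis chain_lengths_single empty_iff)

lemma quotient_dist_ge_1:
  assumes "y \<in> f ` X" "y' \<in> f ` X" "y \<noteq> y'"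
  shows "1 \<le> quotient_dist X d f y y'"
proof -
  have "1 \<le> Inf (chain_lengths X d f y y')"
    using chain_lengths_nonempty[OF assms(1,2)] chain_lengths_ge_1 by (rule cInf_greatest)
  then show ?thesis
    using assms by (simp add: quotient_dist_def)
qed

lemma quotient_dist_nonneg: "0 \<le> quotient_dist X d f y y'"
proof (cases "y \<in> f ` X \<and> y' \<in> f ` X \<and> y \<noteq> y'")
  case True
  then have "1 \<le> quotient_dist X d f y y'"
    by (intro quotient_dist_ge_1) auto
  then show ?thesis
    by linarith
qed (auto simp: quotient_dist_def)

text \<open>The bound survives the default value 0, taken for equal points and outside the image of
  \<open>X\<close>, because every chain has length at least 1. Later estimates thus avoid a case
  distinction.\<close>

lemma quotient_dist_le:
  assumes "s \<in> chain_lengths X d f y y'"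
  shows "quotient_dist X d f y y' \<le> s"
  using cInf_lower[OF assms bdd_below_chain_lengths] chain_lengths_ge_1[OF assms]
  by (simp add: quotient_dist_def)

lemma quotient_dist_triangle:
  assumes Y: "x \<in> f ` X" "y \<in> f ` X" "z \<in> f ` X"
  shows "quotient_dist X d f x z \<le> quotient_dist X d f x y + quotient_dist X d f y z"
\<comment> \<open>Here one summand is 0 by definition, whereas chains from a point to itself have
  length at least 1, so these cases cannot go through the infima.\<close>
proof (cases "x = y \<or> y = z")
  case True
  then show ?thesis
    by (auto simp: quotient_dist_def)
next
  case False
  let ?q = "quotient_dist X d f"
  \<comment> \<open>The two infima are treated one at a time: first over chains from
    \<open>x\<close> to \<open>y\<close> with \<open>t\<close> fixed, then over
    \<open>t\<close>.\<close>
  have "?q x z - t \<le> Inf (chain_lengths X d f x y)" if "t \<in> chain_lengths X d f y z" for t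
    using quotient_dist_le[OF chain_lengths_append[OF _ that]] Y
    by (intro cInf_greatest chain_lengths_nonempty) (auto simp: algebra_simps)
  then have "?q x z - Inf (chain_lengths X d f x y) \<le> Inf (chain_lengths X d f y z)"
    using Y by (intro cInf_greatest chain_lengths_nonempty) (auto simp: algebra_simps)
  with False Y show ?thesis
    by (simp add: quotient_dist_def algebra_simps)
qed

lemma Metric_space_quotient_dist: "Metric_space (f ` X) (quotient_dist X d f)"
proof
  show "quotient_dist X d f y y' = quotient_dist X d f y' y" for y y'
  proof -
    have "chain_lengths X d f y y' = chain_lengths X d f y' y"
      by (intro equalityI subsetI) (erule chain_lengths_reverse[OF commute])+
    then show ?thesis
      by (auto simp: quotient_dist_def)
  qed
  show "quotient_dist X d f y y' = 0 \<longleftrightarrow> y = y'" if "y \<in> f ` X" "y' \<in> f ` X" for y y'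
  proof
    show "y = y'" if "quotient_dist X d f y y' = 0"
      using quotient_dist_ge_1[OF \<open>y \<in> f ` X\<close> \<open>y' \<in> f ` X\<close>] that by linarith
  qed (simp add: quotient_dist_def)
qed (simp_all add: quotient_dist_nonneg quotient_dist_triangle)

section \<open>Universal property of the quotient structure\<close>

lemma image_family_in_metric_lss:
  assumes "\<U> \<in> metric_lss X d"
  shows "(`) f ` \<U> \<in> metric_lss (f ` X) (quotient_dist X d f)"
proof -
  obtain R where R: "\<And>U x y. \<lbrakk>U \<in> \<U>; x \<in> U; y \<in> U\<rbrakk> \<Longrightarrow> d x y \<le> R"
    using assms by (rule metric_lssE) (rule that)
  note sub = metric_lss_subset[OF assms]
  show ?thesis
  proof (rule metric_lssI)
    show "(`) f ` \<U> \<subseteq> Pow (f ` X)"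
      using sub by blast
    fix W y y' assume "W \<in> (`) f ` \<U>" "y \<in> W" "y' \<in> W"
    then obtain U x x' where U: "U \<in> \<U>" "x \<in> U" "x' \<in> U" "y = f x" "y' = f x'"
      by blast
    \<comment> \<open>A single link from \<open>x\<close> to \<open>x'\<close> is already a
      chain.\<close>
    then have "quotient_dist X d f y y' \<le> 1 + d x x'"
      using sub by (auto intro!: quotient_dist_le chain_lengths_single)
    with R[OF U(1-3)] show "quotient_dist X d f y y' \<le> 1 + R"
      by linarith
  qed
qed

text \<open>Some family of iterated stars lies in \<open>\<Z>\<close>, and every member of
  \<open>\<B>\<close> with two points fits into one of these stars; the first axiom then gives
  \<open>\<B> \<in> \<Z>\<close>.\<close>

lemma metric_lss_quotient_dist_subset:
  assumes lss: "large_scale_structure (f ` X) \<Z>"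
    and images: "\<And>\<U>. \<U> \<in> metric_lss X d \<Longrightarrow> (`) f ` \<U> \<in> \<Z>"
  shows "metric_lss (f ` X) (quotient_dist X d f) \<subseteq> \<Z>"
proof
  fix \<B> assume \<B>: "\<B> \<in> metric_lss (f ` X) (quotient_dist X d f)"
  obtain R where R: "\<And>B y y'. \<lbrakk>B \<in> \<B>; y \<in> B; y' \<in> B\<rbrakk> \<Longrightarrow> quotient_dist X d f y y' \<le> R"
    using \<B> by (rule metric_lssE) (rule that)
  \<comment> \<open>Strictness matters: an infimum below \<open>N\<close> yields an actual chain of
    length below \<open>N\<close>.\<close>
  obtain N :: nat where N: "R < real N"
    using reals_Archimedean2 by blast
  define \<U> where "\<U> = {{a, b} | a b. a \<in> X \<and> b \<in> X \<and> d a b \<le> real N}"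
  define \<V> where "\<V> = (`) f ` \<U>"
  have "\<U> \<in> metric_lss X d"
    by (rule metric_lssI[where R = "real N"]) (auto simp: \<U>_def commute)
  then have \<V>: "\<V> \<in> \<Z>"
    unfolding \<V>_def by (rule images)
  have link: "{f a, f b} \<in> \<V>" if "a \<in> X" "b \<in> X" "d a b \<le> real N" for a b
    using that unfolding \<V>_def \<U>_def by (intro image_eqI[of _ _ "{a, b}"]) auto
  \<comment> \<open>The degenerate pair \<open>{a, a}\<close> occurs since \<open>d a a = 0\<close>,
    so \<open>\<V>\<close> covers the image; monotonicity of the iterated stars rests on
    this.\<close>
  have "f a \<in> \<Union>\<V>" if "a \<in> X" for a
    using link[OF that that] that by auto
  then have cover: "\<Union>\<V> = f ` X"
    unfolding \<V>_def \<U>_def by auto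
  have sub: "\<B> \<subseteq> Pow (f ` X)"
    using \<B> by (rule metric_lss_subset)
  let ?S = "\<lambda>y. ((\<lambda>A. star A \<V>) ^^ N) {y}"
  have in_star: "y' \<in> ?S y" if B: "B \<in> \<B>" "y \<in> B" "y' \<in> B" for B y y'
  proof -
    have Y: "y \<in> f ` X" "y' \<in> f ` X"
      using B sub by auto
    show ?thesis
    proof (cases "y = y'")
      case True
      then show ?thesis
        using iterated_star_mono[OF cover, of "{y}" 0 N] Y by auto
    next
      case False
      then have "Inf (chain_lengths X d f y y') < real N"
        using R[OF B] N Y by (simp add: quotient_dist_def)
      then obtain s where chain: "s \<in> chain_lengths X d f y y'" and s: "s < real N"
        using cInf_lessD chain_lengths_nonempty Y by metis
      obtain n a b where n: "1 \<le> n" "\<And>i. \<lbrakk>1 \<le> i; i \<le> n\<rbrakk> \<Longrightarrow> a i \<in> X \<and> b i \<in> X"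
        "f (a 1) = y" "f (b n) = y'" "\<And>i. \<lbrakk>1 \<le> i; i < n\<rbrakk> \<Longrightarrow> f (b i) = f (a (Suc i))"
        "s = real n + (\<Sum>i=1..n. d (a i) (b i))"
        using chain by (rule chain_lengthsE) (rule that)
      have "0 \<le> (\<Sum>i=1..n. d (a i) (b i))"
        by (simp add: sum_nonneg)
      \<comment> \<open>As distances are nonnegative, \<open>s < real N\<close> bounds both the
        number of links and, below, each single distance in the chain.\<close>
      then have "n \<le> N"
        using s n(6) by linarith
      have "{f (a i), f (b i)} \<in> \<V>" if i: "1 \<le> i" "i \<le> n" for i
      proof (rule link)
        have "d (a i) (b i) \<le> (\<Sum>i=1..n. d (a i) (b i))"
          using i by (intro member_le_sum) auto
        then show "d (a i) (b i) \<le> real N"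
          using s n(6) by linarith
      qed (use n(2)[OF i] in auto)
      then have "f (b n) \<in> ((\<lambda>A. star A \<V>) ^^ n) {f (a 1)}"
        using n(5,1) by (rule chain_in_iterated_star)
      then have "y' \<in> ((\<lambda>A. star A \<V>) ^^ n) {y}"
        by (simp only: n(3,4))
      \<comment> \<open>The number \<open>n\<close> depends on the pair; padding up to
        \<open>N\<close> gives one exponent for all pairs.\<close>
      then show ?thesis
        using iterated_star_mono[OF cover, of "{y}" n N] \<open>n \<le> N\<close> Y by auto
    qed
  qed
  have "\<forall>B\<in>\<B>. (\<exists>x\<in>B. \<exists>y\<in>B. x \<noteq> y) \<longrightarrow> (\<exists>A\<in>?S ` (f ` X). B \<subseteq> A)"
  proof (intro ballI impI)
    fix B assume B: "B \<in> \<B>" and "\<exists>x\<in>B. \<exists>y\<in>B. x \<noteq> y"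
    \<comment> \<open>Any point of \<open>B\<close> serves as centre; having two points ensures that
      \<open>B\<close> is nonempty.\<close>
    then obtain y where "y \<in> B"
      by blast
    then have "B \<subseteq> ?S y" "y \<in> f ` X"
      using B in_star sub by auto
    then show "\<exists>A\<in>?S ` (f ` X). B \<subseteq> A"
      by blast
  qed
  moreover have "?S ` (f ` X) \<in> \<Z>"
    using lss \<V> by (rule iterated_star_family_in_lss)
  moreover have "\<B> \<in> Pow (Pow (f ` X))"
    using sub by blast
  ultimately show "\<B> \<in> \<Z>"
    using lss unfolding large_scale_structure_def by blast
qed

end

theorem corollary7p3:
  fixes X :: "'a set" and d :: "'a \<Rightarrow> 'a \<Rightarrow> real"
    and f :: "'a \<Rightarrow> 'b" and Y :: "'b set"
  assumes "Metric_space X d"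
    and "f ` X = Y"
  shows "Metric_space Y (quotient_dist X d f) \<and>
         is_quotient_lss f (metric_lss X d) Y (metric_lss Y (quotient_dist X d f))"
  using Metric_space_quotient_dist[OF assms(1), of f]
    large_scale_structure_metric_lss[OF Metric_space_quotient_dist[OF assms(1), of f]]
    image_family_in_metric_lss[OF assms(1), of _ f]
    metric_lss_quotient_dist_subset[OF assms(1), of f]
  unfolding is_quotient_lss_def assms(2) by simp

end
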